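(* Let $x_1\in(0,\frac13)$, $x_2\in(\frac13,\frac23)$ and $x_3\in(\frac23,1)$ be real numbers, each of which is either rational or an irrational number whose $4$-ary expansion contains all words of length $3$ over $\{0,1,2,3\}$ (as blocks of consecutive digits). Let $(d_1,d_2,d_3)$ be the vector with positive entries satisfying $$d_1=\frac{1}{3x_1}-1,\qquad d_2=\frac{2-3x_2}{3x_2-1},\qquad d_3=\frac{3-3x_3}{3x_3-2}.$$ Then, for any switched server system with positive parameters $d_{ij}$ ($1\le i,j\le 3$, $i\ne j$) satisfying $$\frac{d_{13}}{d_{12}}=d_1,\qquad \frac{d_{21}}{d_{23}}=d_2,\qquad \frac{d_{32}}{d_{31}}=d_3,$$ the global attractor $\omega(F)$ of its Poincaré map $F:\partial\Delta\to\partial\Delta$ is finite (so that the system has no fractal attractor).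
   Context: Switched server system: there are three tanks $1,2,3$ and one server. At each time $t\ge0$ fluid is delivered to each tank at constant rate $\rho_i=\frac13$ ($i=1,2,3$) and is removed by the server from the tank where the server is located at constant rate $\rho=1$. Let $v_i(t)$ be the volume in tank $i$ at time $t$; the total volume is normalised to $1$, so the state $\mathbf{v}(t)=(v_1(t),v_2(t),v_3(t))$ lies in $$\Delta=\{(v_1,v_2,v_3): v_1,v_2,v_3\ge0,\ v_1+v_2+v_3=1\}.$$ When tank $i$ is emptied by the server at time $t$, the server moves to the tank $j\ne i$ with the largest scaled volume $d_{ij}v_j(t)$, where $d_{ij}>0$ are the parameters of the system. In case of a tie, the server goes from tank $1$ to tank $3$, from tank $2$ to tank $1$, and from tank $3$ to tank $2$. The boundary $\partial\Delta$ is the set of $\mathbf{v}\in\Delta$ having at least one zero coordinate. The Poincaré map $F:\partial\Delta\to\partial\Delta$ is the map induced by the flow: if $\mathbf{v}\in\partial\Delta$ with $v_i=0$ and $j\neq i$ is the tank with the largest scaled volume $d_{ij}v_j$ among the two tanks different from $i$ (where, in case of a tie, $j=3$ if $i=1$, $j=1$ if $i=2$, and $j=2$ if $i=3$), then $F(\mathbf{v})$ is the state of the system at the moment when tank $j$ is emptied, that is, with $\mathbf{e}_1,\mathbf{e}_2,\mathbf{e}_3$ the standard basis vectors, $$F(\mathbf{v})=\mathbf{v}+\frac{v_j}{2}(1,1,1)-\frac{3v_j}{2}\mathbf{e}_j.$$ (At a vertex $\mathbf{e}_j$ of $\Delta$ the selected tank is $j$, regardless of which of the two zero coordinates is taken as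 $i$.) Equivalently, let $\phi:[0,1)\to\partial\Delta$ be the bijection given by the constant-speed anticlockwise parametrisation of $\partial\Delta$ with $\phi(0)=(0,1,0)$, $\phi(\frac13)=(0,0,1)$, $\phi(\frac23)=(1,0,0)$ (affine on each of $[0,\frac13]$, $[\frac13,\frac23]$, $[\frac23,1)$). Then $F=\phi\circ f\circ\phi^{-1}$, where $f:[0,1)\to[0,1)$ is given by $f(x)=-\frac12x+\frac12$ on $[0,x_1)\cup[x_2,x_3)$ and $f(x)=-\frac12x+1$ on $[x_1,x_2)\cup[x_3,1)$, with $x_1,x_2,x_3$ related to $d_1,d_2,d_3$ by the formulas in the claim. The global attractor of $F$ is $$\omega(F)=\bigcup_{\mathbf{v}\in\partial\Delta}\omega(\mathbf{v},F),\qquad \omega(\mathbf{v},F)=\bigcap_{r\ge0}\overline{\bigcup_{k\ge r}\{F^k(\mathbf{v})\}},$$ with closures in $\partial\Delta$. *)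

theory Defs
  imports "HOL-Analysis.Analysis"
begin

definition state_space :: "(real^3) set" where
  "state_space = {v. (\<forall>i. v $ i \<ge> 0) \<and> (\<Sum>i\<in>UNIV. v $ i) = 1}"

definition state_boundary :: "(real^3) set" where
  "state_boundary = {v \<in> state_space. \<exists>i. v $ i = 0}"

text \<open>
  Tanks are the elements \<open>1, 2, 3\<close> of the type \<open>3\<close>, whose arithmetic is modulo 3
  (so \<open>3 = 0\<close>). Hence \<open>i - 1\<close> and \<open>i + 1\<close> are the two tanks different from \<open>i\<close>, and
  \<open>i - 1\<close> is the one preferred in a tie: \<open>1\<close> goes to \<open>3\<close>, \<open>2\<close> to \<open>1\<close>, \<open>3\<close> to \<open>2\<close>.
\<close>

definition next_tank :: "(3 \<Rightarrow> 3 \<Rightarrow> real) \<Rightarrow> 3 \<Rightarrow> real^3 \<Rightarrow> 3" where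
  "next_tank d i v =
     (if d i (i + 1) * v $ (i + 1) > d i (i - 1) * v $ (i - 1) then i + 1 else i - 1)"

text \<open>
  The state at the moment when the server, starting in state \<open>v\<close>, has emptied tank \<open>j\<close>:
  tank \<open>j\<close> drains at net rate \<open>2/3\<close>, hence in time \<open>3 * v $ j / 2\<close>, during which the
  other two tanks gain \<open>v $ j / 2\<close> each.
\<close>

definition empty_tank :: "3 \<Rightarrow> real^3 \<Rightarrow> real^3" where
  "empty_tank j v = v + (v $ j / 2) *\<^sub>R (\<chi> k. 1) - (3 * v $ j / 2) *\<^sub>R axis j 1"

text \<open>
  On \<open>state_boundary\<close> the result does not depend on the chosen empty tank, see
  \<open>poincare_map_eq\<close> below. Outside \<open>state_boundary\<close> the value is irrelevant.
\<close>

definition poincare_map :: "(3 \<Rightarrow> 3 \<Rightarrow> real) \<Rightarrow> real^3 \<Rightarrow> real^3" where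
  "poincare_map d v = empty_tank (next_tank d (SOME i. v $ i = 0) v) v"

definition omega_limit :: "'a::topological_space set \<Rightarrow> ('a \<Rightarrow> 'a) \<Rightarrow> 'a \<Rightarrow> 'a set" where
  "omega_limit S F v = (\<Inter>r::nat. top_of_set S closure_of (\<Union>k\<in>{r..}. {(F ^^ k) v}))"

definition global_attractor :: "'a::topological_space set \<Rightarrow> ('a \<Rightarrow> 'a) \<Rightarrow> 'a set" where
  "global_attractor S F = (\<Union>v\<in>S. omega_limit S F v)"

text \<open>
  The \<open>n\<close>-th digit after the point (counting from \<open>0\<close>) of the 4-ary expansion of
  \<open>x \<in> {0..<1}\<close>. The expansion is only used for irrational \<open>x\<close>, where it is unique.
\<close>

definition digit4 :: "real \<Rightarrow> nat \<Rightarrow> int" where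
  "digit4 x n = \<lfloor>4 ^ Suc n * x\<rfloor> mod 4"

definition contains_word4 :: "real \<Rightarrow> int list \<Rightarrow> bool" where
  "contains_word4 x w \<longleftrightarrow> (\<exists>n. \<forall>k<length w. digit4 x (n + k) = w ! k)"

definition rational_or_rich :: "real \<Rightarrow> bool" where
  "rational_or_rich x \<longleftrightarrow>
     x \<in> \<rat> \<or>
     x \<notin> \<rat> \<and> (\<forall>w. length w = 3 \<and> set w \<subseteq> {0, 1, 2, 3} \<longrightarrow> contains_word4 x w)"

lemma tank_cases: "i = 1 \<or> i = 2 \<or> i = 3" for i :: 3
  using exhaust_3 by blast

lemma tank_arith:
  "(1::3) + 1 = 2" "(2::3) + 1 = 3" "(3::3) + 1 = 1"
  "(1::3) - 1 = 3" "(2::3) - 1 = 1" "(3::3) - 1 = 2"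
  by simp_all

lemma next_tank_eq:
  assumes d: "\<And>i j. i \<noteq> j \<Longrightarrow> d i j > 0"
    and v: "v \<in> state_boundary" and i: "v $ i = 0" and i': "v $ i' = 0"
  shows "next_tank d i v = next_tank d i' v"
proof (cases "i = i'")
  case False
  have sum: "v $ 1 + v $ 2 + v $ 3 = 1"
    using v by (simp add: state_boundary_def state_space_def sum_3)
  have pos: "d 1 2 > 0" "d 1 3 > 0" "d 2 1 > 0" "d 2 3 > 0" "d 3 1 > 0" "d 3 2 > 0"
    by (auto intro!: d)
  show ?thesis
    using tank_cases[of i] tank_cases[of i'] False i i' sum pos
    unfolding next_tank_def
    by (elim disjE) (simp_all only: tank_arith, auto)
qed simp

lemma poincare_map_eq:
  assumes "\<And>i j. i \<noteq> j \<Longrightarrow> d i j > 0" "v \<in> state_boundary" "v $ i = 0"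
  shows "poincare_map d v = empty_tank (next_tank d i v) v"
  unfolding poincare_map_def
  using next_tank_eq[OF assms(1) assms(2) someI[of "\<lambda>i. v $ i = 0" i] assms(3)] assms(3)
  by simp

lemma poincare_map_state_boundary:
  assumes v: "v \<in> state_boundary"
  shows "poincare_map d v \<in> state_boundary"
proof -
  have "empty_tank j v \<in> state_boundary" for j
  proof -
    have sum: "v $ 1 + v $ 2 + v $ 3 = 1"
      using v by (auto simp: state_boundary_def state_space_def sum_3)
    have "empty_tank j v $ j = 0"
      by (simp add: empty_tank_def axis_def)
    moreover have "empty_tank j v $ k \<ge> 0" for k
      using v by (simp add: empty_tank_def axis_def state_boundary_def state_space_def)
    moreover have "(\<Sum>k\<in>UNIV. empty_tank j v $ k) = 1"
      using tank_cases[of j] sum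
      by (elim disjE) (simp_all add: empty_tank_def axis_def sum_3)
    ultimately show ?thesis
      by (auto simp: state_boundary_def state_space_def)
  qed
  then show ?thesis
    by (simp add: poincare_map_def)
qed

end

theory Submission
  imports Defs
begin

text \<open>
  In the arc-length coordinate of the boundary, the Poincare map is a piecewise contraction
  \<open>f\<close> of \<open>{0..<1}\<close> with slope \<open>-1/2\<close> and discontinuities \<open>x1, x2, x3\<close>, and it is a right
  inverse of the expanding map \<open>E x = -2x mod 1\<close>. Hence every iterated \<open>f\<close>-preimage of \<open>xi\<close>
  lies on the \<open>E\<close>-orbit of \<open>xi\<close>. This orbit is finite if \<open>xi\<close> is rational. If \<open>xi\<close> is rich,
  then, since \<open>E (E x) = 4x mod 1\<close>, its orbit visits every 4-adic interval of length \<open>1/64\<close>,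
  in particular one that misses the range of \<open>f\<close>, and from there on \<open>xi\<close> has no preimages.
  So the set \<open>B\<close> of all iterated preimages of the discontinuities is finite. The points and the
  complementary intervals of \<open>B\<close> form a finite partition whose cells \<open>f\<close> maps into cells,
  contracting distances by \<open>1/2\<close>. All orbits starting in one cell are therefore asymptotic to
  each other, and since the itinerary of cells is eventually periodic, to a finite set.
\<close>

section \<open>Finite attractors from invariant contracted partitions\<close>

text \<open>For each \<open>e > 0\<close> a tail of the orbit lies in the closed
  \<open>e\<close>-neighbourhood of \<open>L\<close>, hence so does its closure. Closures relative
  to \<open>S\<close> are contained in those of the whole space.\<close>

lemma omega_limit_subset_if_infdist_tendsto_0:
  fixes F :: "'a::metric_space \<Rightarrow> 'a"
  assumes "closed L" "L \<noteq> {}" and lim: "(\<lambda>n. infdist ((F ^^ n) v) L) \<longlonglongrightarrow> 0"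
  shows "omega_limit S F v \<subseteq> L"
proof
  fix w assume w: "w \<in> omega_limit S F v"
  have "infdist w L \<le> e" if "e > 0" for e
  proof -
    obtain r where r: "infdist ((F ^^ n) v) L \<le> e" if "n \<ge> r" for n
      using order_tendstoD(2)[OF lim \<open>e > 0\<close>]
      unfolding eventually_sequentially by (meson less_imp_le)
    have "w \<in> top_of_set S closure_of (\<Union>k\<in>{r..}. {(F ^^ k) v})"
      using w by (simp add: omega_limit_def)
    then have "w \<in> closure (\<Union>k\<in>{r..}. {(F ^^ k) v})"
      by (metis closure_of_subtopology_subset euclidean_closure_of subsetD)
    moreover have "closed {y. infdist y L \<le> e}"
      by (intro closed_Collect_le continuous_intros)
    then have "closure (\<Union>k\<in>{r..}. {(F ^^ k) v}) \<subseteq> {y. infdist y L \<le> e}"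
      using r by (intro closure_minimal) auto
    ultimately show ?thesis by auto
  qed
  then have "infdist w L = 0"
    by (meson antisym field_le_epsilon infdist_nonneg add_increasing order_refl dense_ge)
  then show "w \<in> L"
    using assms(1,2) by (simp add: in_closed_iff_infdist_zero)
qed

lemma infdist_tendsto_0_transfer:
  fixes u w :: "nat \<Rightarrow> 'a::metric_space"
  assumes "(\<lambda>n. infdist (u n) L) \<longlonglongrightarrow> 0" "(\<lambda>n. dist (w n) (u n)) \<longlonglongrightarrow> 0"
  shows "(\<lambda>n. infdist (w n) L) \<longlonglongrightarrow> 0"
proof (rule tendsto_sandwich[OF _ _ tendsto_const])
  show "(\<lambda>n. infdist (u n) L + dist (w n) (u n)) \<longlonglongrightarrow> 0"
    using tendsto_add[OF assms] by simp
qed (auto simp: infdist_triangle infdist_nonneg)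

lemma convergent_if_geometric_steps:
  fixes u :: "nat \<Rightarrow> 'a::banach"
  assumes c: "0 \<le> c" "c < 1" and step: "\<And>n. dist (u (Suc n)) (u n) \<le> C * c ^ n"
  shows "convergent u"
proof -
  have "summable (\<lambda>n. u (Suc n) - u n)"
    by (rule summable_comparison_test'[of "\<lambda>n. C * c ^ n" 0])
      (use step c in \<open>auto simp: dist_norm intro!: summable_mult\<close>)
  then have "convergent (\<lambda>n. u n - u 0)"
    by (auto simp: summable_iff_convergent sum_lessThan_telescope)
  then show ?thesis
    by (simp add: convergent_diff_const_right_iff)
qed

text \<open>Along each residue class modulo \<open>p\<close> the steps are geometrically small, so
  that subsequence converges; the \<open>p\<close> limits form \<open>L\<close>.\<close>

lemma finite_limit_set_if_geometric_almost_period: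
  fixes u :: "nat \<Rightarrow> 'a::banach"
  assumes c: "0 \<le> c" "c < 1" and p: "p > 0"
    and step: "\<And>n. dist (u (n + p)) (u n) \<le> C * c ^ n"
  obtains L where "finite L" "L \<noteq> {}" "(\<lambda>n. infdist (u n) L) \<longlonglongrightarrow> 0"
proof -
  have "convergent (\<lambda>k. u (k * p + r))" for r
  proof (rule convergent_if_geometric_steps)
    show "0 \<le> c ^ p" "c ^ p < 1"
      using c p by (auto simp: power_less_one_iff)
    show "dist (u (Suc k * p + r)) (u (k * p + r)) \<le> C * c ^ r * (c ^ p) ^ k" for k
      using step[of "k * p + r"] by (simp add: algebra_simps power_add flip: power_mult)
  qed
  then obtain l where l: "(\<lambda>k. u (k * p + r)) \<longlonglongrightarrow> l r" for r
    unfolding convergent_def by metis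
  define L where "L = l ` {..<p}"
  have "(\<lambda>n. infdist (u n) L) \<longlonglongrightarrow> 0"
  proof (rule LIMSEQ_I)
    fix e :: real assume "e > 0"
    then have "\<forall>\<^sub>F k in sequentially. \<forall>r\<in>{..<p}. dist (u (k * p + r)) (l r) < e"
      using l by (intro eventually_ball_finite) (auto simp: tendsto_iff)
    then obtain K where K: "dist (u (k * p + r)) (l r) < e" if "k \<ge> K" "r < p" for k r
      unfolding eventually_sequentially by auto
    have "infdist (u n) L < e" if "n \<ge> K * p" for n
    proof -
      have "n div p \<ge> K" "n mod p < p"
        using that p by (simp_all add: less_eq_div_iff_mult_less_eq)
      then have "dist (u n) (l (n mod p)) < e"
        using K[of "n div p" "n mod p"] by simp
      moreover have "infdist (u n) L \<le> dist (u n) (l (n mod p))"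
        using p by (intro infdist_le) (simp add: L_def)
      ultimately show ?thesis by simp
    qed
    then show "\<exists>N. \<forall>n\<ge>N. norm (infdist (u n) L - 0) < e"
      by (auto simp: infdist_nonneg)
  qed
  moreover have "finite L" "L \<noteq> {}"
    using p by (auto simp: L_def)
  ultimately show ?thesis using that by blast
qed

text \<open>The cells are the fibres of the labelling \<open>cell\<close>. Contraction takes place
  in \<open>A\<close>, and \<open>h\<close> carries the estimates over to orbits of
  \<open>F\<close>.\<close>

lemma finite_global_attractor_if_contracting_partition:
  fixes F :: "'a::banach \<Rightarrow> 'a" and f :: "'b::metric_space \<Rightarrow> 'b" and cell :: "'b \<Rightarrow> 'c"
  assumes S: "S \<subseteq> h ` A"
    and f: "\<And>x. x \<in> A \<Longrightarrow> f x \<in> A"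
    and conj: "\<And>x. x \<in> A \<Longrightarrow> F (h x) = h (f x)"
    and lip: "\<And>x y. x \<in> A \<Longrightarrow> y \<in> A \<Longrightarrow> dist (h x) (h y) \<le> K * dist x y"
    and fin: "finite (cell ` A)"
    and inv: "\<And>x y. x \<in> A \<Longrightarrow> y \<in> A \<Longrightarrow> cell x = cell y \<Longrightarrow> cell (f x) = cell (f y)"
    and contr: "\<And>x y. x \<in> A \<Longrightarrow> y \<in> A \<Longrightarrow> cell x = cell y \<Longrightarrow> dist (f x) (f y) \<le> c * dist x y"
    and c: "0 \<le> c" "c < 1" and K: "0 \<le> K"
  shows "finite (global_attractor S F)"
proof -
  have fn: "(f ^^ n) x \<in> A" if "x \<in> A" for n x
    using that by (induction n) (auto simp: f)
  have conj_n: "(F ^^ n) (h x) = h ((f ^^ n) x)" if "x \<in> A" for n x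
    using that by (induction n) (auto simp: conj fn)
  have same_n: "cell ((f ^^ n) x) = cell ((f ^^ n) y) \<and> dist ((f ^^ n) x) ((f ^^ n) y) \<le> c ^ n * dist x y"
    if "x \<in> A" "y \<in> A" "cell x = cell y" for n x y
  proof (induction n)
    case (Suc n)
    have "dist ((f ^^ Suc n) x) ((f ^^ Suc n) y) \<le> c * dist ((f ^^ n) x) ((f ^^ n) y)"
      unfolding funpow.simps comp_apply by (intro contr fn that conjunct1[OF Suc])
    also have "\<dots> \<le> c * (c ^ n * dist x y)"
      using Suc c by (intro mult_left_mono) auto
    finally have "dist ((f ^^ Suc n) x) ((f ^^ Suc n) y) \<le> c ^ Suc n * dist x y"
      by (simp add: mult.assoc)
    moreover have "cell ((f ^^ Suc n) x) = cell ((f ^^ Suc n) y)"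
      unfolding funpow.simps comp_apply by (intro inv fn that conjunct1[OF Suc])
    ultimately show ?case by blast
  qed (use that in auto)
  have close: "dist (h ((f ^^ n) x)) (h ((f ^^ n) y)) \<le> K * dist x y * c ^ n"
    if "x \<in> A" "y \<in> A" "cell x = cell y" for n x y
    using lip[OF fn fn, OF that(1,2), of n n] mult_left_mono[OF conjunct2[OF same_n[OF that]] K, of n]
    by (simp add: algebra_simps)
  have limit_set: "\<exists>L. finite L \<and> L \<noteq> {} \<and> (\<lambda>n. infdist (h ((f ^^ n) x)) L) \<longlonglongrightarrow> 0"
    if x: "x \<in> A" for x
  proof -
    have "finite (range (\<lambda>n. cell ((f ^^ n) x)))"
      by (rule finite_subset[OF _ fin]) (use fn x in auto)
    then have "\<not> inj (\<lambda>n. cell ((f ^^ n) x))"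
      using finite_imageD by blast
    \<comment> \<open>By pigeonhole some label repeats. Then \<open>y\<close> and its
      \<open>p\<close>-th iterate share a cell, so their orbits approach each other geometrically:
      \<open>p\<close> is an almost period.\<close>
    then obtain m n where mn: "cell ((f ^^ m) x) = cell ((f ^^ n) x)" "m < n"
      unfolding inj_def by (metis linorder_neqE_nat)
    define y p where "y = (f ^^ m) x" and "p = n - m"
    have "(f ^^ p) y = (f ^^ (p + m)) x"
      by (simp add: y_def funpow_add)
    then have "cell ((f ^^ p) y) = cell y" "y \<in> A" "p > 0"
      using mn fn x by (auto simp: y_def p_def)
    then obtain L where L: "finite L" "L \<noteq> {}" "(\<lambda>n. infdist (h ((f ^^ n) y)) L) \<longlonglongrightarrow> 0"
      using finite_limit_set_if_geometric_almost_period[OF c, of p "\<lambda>n. h ((f ^^ n) y)" "K * dist ((f ^^ p) y) y"]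
        close[OF fn, of y y p] by (auto simp: funpow_add)
    have "(\<lambda>n. infdist (h ((f ^^ (n + m)) x)) L) \<longlonglongrightarrow> 0"
      using L(3) by (simp add: y_def funpow_add)
    then show ?thesis
      using L(1,2) LIMSEQ_offset[of "\<lambda>n. infdist (h ((f ^^ n) x)) L"] by blast
  qed
  \<comment> \<open>The limit set of one representative serves its whole cell, so the attractor is
    covered by a union over finitely many cells.\<close>
  have "\<exists>L. finite L \<and> (\<forall>x\<in>A. cell x = a \<longrightarrow> omega_limit S F (h x) \<subseteq> L)" if "a \<in> cell ` A" for a
  proof -
    obtain x where x: "x \<in> A" "cell x = a"
      using \<open>a \<in> cell ` A\<close> by auto
    obtain L where L: "finite L" "L \<noteq> {}" "(\<lambda>n. infdist (h ((f ^^ n) x)) L) \<longlonglongrightarrow> 0"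
      using limit_set[OF x(1)] by auto
    have "omega_limit S F (h y) \<subseteq> L" if y: "y \<in> A" "cell y = a" for y
    proof (rule omega_limit_subset_if_infdist_tendsto_0)
      have "(\<lambda>n. dist (h ((f ^^ n) y)) (h ((f ^^ n) x))) \<longlonglongrightarrow> 0"
      proof (rule tendsto_sandwich[OF _ _ tendsto_const])
        show "(\<lambda>n. K * dist y x * c ^ n) \<longlonglongrightarrow> 0"
          using c by (intro tendsto_mult_right_zero LIMSEQ_power_zero) auto
      qed (use close x y in auto)
      then show "(\<lambda>n. infdist ((F ^^ n) (h y)) L) \<longlonglongrightarrow> 0"
        using infdist_tendsto_0_transfer[OF L(3)] conj_n[OF y(1)] by simp
    qed (use L in \<open>auto simp: finite_imp_closed\<close>)
    then show ?thesis using L(1) by blast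
  qed
  then obtain L where L: "\<And>a. a \<in> cell ` A \<Longrightarrow> finite (L a)"
    "\<And>a x. a \<in> cell ` A \<Longrightarrow> x \<in> A \<Longrightarrow> cell x = a \<Longrightarrow> omega_limit S F (h x) \<subseteq> L a"
    by metis
  have "global_attractor S F \<subseteq> (\<Union>a\<in>cell ` A. L a)"
    using S L(2) unfolding global_attractor_def by blast
  then show ?thesis
    using finite_subset fin L(1) by blast
qed

section \<open>The interval map\<close>

definition expand :: "real \<Rightarrow> real" where
  "expand x = frac (- 2 * x)"

text \<open>Two steps cancel the sign and multiply by 4, which is the shift of 4-ary digits.\<close>

lemma expand_expand: "expand (expand x) = frac (4 * x)"
proof -
  have "- 2 * frac (- 2 * x) = 4 * x + of_int (2 * \<lfloor>- 2 * x\<rfloor>)"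
    by (simp add: frac_def)
  then show ?thesis
    unfolding expand_def by (metis frac_add_of_int_right)
qed

lemma expand_funpow_double: "0 \<le> x \<Longrightarrow> x < 1 \<Longrightarrow> (expand ^^ (2 * n)) x = frac (4 ^ n * x)"
proof (induction n)
  case 0
  then show ?case by (simp add: frac_eq)
next
  case (Suc n)
  have "4 * frac (4 ^ n * x) = 4 ^ Suc n * x + of_int (- 4 * \<lfloor>4 ^ n * x\<rfloor>)"
    by (simp add: frac_def)
  then have "frac (4 * frac (4 ^ n * x)) = frac (4 ^ Suc n * x)"
    by (metis frac_add_of_int_right)
  then show ?case
    using Suc by (simp add: expand_expand)
qed

text \<open>Multiplying by an integer and reducing modulo 1 keeps a common denominator
  \<open>q\<close>.\<close>

lemma finite_expand_orbit_rational:
  assumes "x \<in> \<rat>" "0 \<le> x" "x < 1"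
  shows "finite (range (\<lambda>n. (expand ^^ n) x))"
proof -
  obtain a :: int and q :: nat where q: "q > 0" "x = a / q"
    using assms(1) by (metis Rats_cases' of_int_of_nat_eq pos_int_cases of_nat_0_less_iff)
  let ?Q = "(\<lambda>b. real_of_int b / real q) ` {0..int q}"
  have "expand y \<in> ?Q" if "y \<in> ?Q" for y
  proof -
    obtain b :: int where b: "y = b / q"
      using \<open>y \<in> ?Q\<close> by blast
    have y: "expand y = real_of_int (- 2 * b - \<lfloor>- 2 * y\<rfloor> * q) / q"
      using q(1) by (simp add: expand_def frac_def b field_simps)
    have "0 \<le> expand y" "expand y \<le> 1"
      by (auto simp: expand_def frac_lt_1 less_imp_le)
    then have "0 \<le> real_of_int (- 2 * b - \<lfloor>- 2 * y\<rfloor> * q)" "real_of_int (- 2 * b - \<lfloor>- 2 * y\<rfloor> * q) \<le> q"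
      using q(1) unfolding y by (simp_all add: zero_le_divide_iff divide_le_eq)
    then have "- 2 * b - \<lfloor>- 2 * y\<rfloor> * q \<in> {0..int q}"
      by (metis atLeastAtMost_iff of_int_0_le_iff of_int_le_iff of_int_of_nat_eq)
    then show ?thesis
      unfolding y by blast
  qed
  moreover have "x \<in> ?Q"
    using assms(2,3) q by (auto simp: zero_le_divide_iff divide_less_eq less_imp_le)
  ultimately have "(expand ^^ n) x \<in> ?Q" for n
    by (induction n) auto
  then show ?thesis
    by (intro finite_subset[OF image_subsetI, of UNIV _ ?Q]) simp_all
qed

text \<open>An interval of length 1/32 contains a full 4-adic interval of length 1/64, which is
  prescribed by a word of three digits.\<close>

lemma rich_frac_in_interval:
  assumes rich: "\<And>w. length w = 3 \<Longrightarrow> set w \<subseteq> {0, 1, 2, 3} \<Longrightarrow> contains_word4 x w"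
    and ab: "0 \<le> a" "b \<le> 1" "a + 1/32 \<le> b"
  obtains n where "a < frac (4 ^ n * x)" "frac (4 ^ n * x) < b"
proof -
  \<comment> \<open>The \<open>+ 1\<close> puts \<open>M / 64\<close> strictly above
    \<open>a\<close>; the next grid point is still at most \<open>b\<close> because 2/64 =
    1/32.\<close>
  define M where "M = \<lfloor>64 * a\<rfloor> + 1"
  have M: "64 * a < M" "M + 1 \<le> 64 * b"
    using ab unfolding M_def by linarith+
  have "0 \<le> M" "M < 64"
    using M ab by linarith+
  let ?w = "[M div 4 div 4, M div 4 mod 4, M mod 4]"
  have digit: "c \<in> {0, 1, 2, 3}" if "0 \<le> c" "c < 4" for c :: int
    using that by auto
  have "M div 4 div 4 < 4"
    using \<open>M < 64\<close> by simp
  then have "set ?w \<subseteq> {0, 1, 2, 3}"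
    using \<open>0 \<le> M\<close> by (simp add: digit pos_imp_zdiv_nonneg_iff del: insert_iff)
  then have "contains_word4 x ?w"
    by (intro rich) simp_all
  then obtain n where "\<forall>k<length ?w. digit4 x (n + k) = ?w ! k"
    unfolding contains_word4_def by blast
  then have n: "digit4 x (n + k) = ?w ! k" if "k < 3" for k
    using that by simp
  define z where "z = frac (4 ^ n * x)"
  \<comment> \<open>Dropping the integer part of \<open>4 ^ n * x\<close> changes the floor by a
    multiple of 4 only.\<close>
  have digits: "digit4 x (n + k) = \<lfloor>4 ^ Suc k * z\<rfloor> mod 4" for k
  proof -
    have "4 ^ Suc (n + k) * x = 4 ^ Suc k * z + of_int (4 * (4 ^ k * \<lfloor>4 ^ n * x\<rfloor>))"
      by (simp add: z_def frac_def power_add algebra_simps)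
    then have "\<lfloor>4 ^ Suc (n + k) * x\<rfloor> = \<lfloor>4 ^ Suc k * z\<rfloor> + 4 * (4 ^ k * \<lfloor>4 ^ n * x\<rfloor>)"
      by (metis floor_add_int)
    then show ?thesis
      by (simp add: digit4_def)
  qed
  define q where "q = \<lfloor>64 * z\<rfloor>"
  have D: "\<lfloor>4 ^ Suc k * z\<rfloor> mod 4 = ?w ! k" if "k < 3" for k
    using n[OF that] unfolding digits .
  have q16: "\<lfloor>16 * z\<rfloor> = q div 4"
    using floor_divide_real_eq_div[of 4 "64 * z"] by (simp add: q_def)
  have q4: "\<lfloor>4 * z\<rfloor> = q div 4 div 4"
    using floor_divide_real_eq_div[of 4 "16 * z"] unfolding q16 by simp
  have "\<lfloor>4 * z\<rfloor> mod 4 = M div 4 div 4"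
    using D[of 0] by simp
  moreover have "\<lfloor>16 * z\<rfloor> mod 4 = M div 4 mod 4"
    using D[of 1] by simp
  moreover have "q mod 4 = M mod 4"
    using D[of 2] by (simp add: q_def)
  \<comment> \<open>Since \<open>z < 1\<close>, the leading digit needs no reduction, so the three
    digits determine \<open>q\<close> and not just its residue.\<close>
  moreover have "q div 4 div 4 mod 4 = q div 4 div 4"
  proof -
    have "0 \<le> z" "z < 1"
      by (simp_all add: z_def frac_lt_1)
    then have "0 \<le> q" "q < 64"
      by (simp_all add: q_def floor_less_iff)
    then show ?thesis
      by (intro mod_pos_pos_trivial) (simp_all add: pos_imp_zdiv_nonneg_iff)
  qed
  ultimately have "q = M"
    unfolding q4 q16 by (metis div_mult_mod_eq)
  then have "M \<le> 64 * z" "64 * z < M + 1"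
    unfolding q_def by linarith+
  then show ?thesis
    using M that[of n] by (simp add: z_def)
qed

section \<open>The piecewise contraction and its iterated preimages\<close>

locale cut_points =
  fixes x1 x2 x3 :: real
  assumes x1: "0 < x1" "x1 < 1/3" and x2: "1/3 < x2" "x2 < 2/3" and x3: "2/3 < x3" "x3 < 1"
begin

text \<open>The half-open pieces encode the tie rule: at a cut point the branch on its right
  applies, which corresponds to tank \<open>i - 1\<close>.\<close>

definition contract :: "real \<Rightarrow> real" where
  "contract x = (if x < x1 \<or> x2 \<le> x \<and> x < x3 then 1/2 - x/2 else 1 - x/2)"

lemma contract_range: "x \<in> {0..<1} \<Longrightarrow> contract x \<in> {0..<1}"
  using x1 by (auto simp: contract_def)

lemma contract_funpow_range: "x \<in> {0..<1} \<Longrightarrow> (contract ^^ n) x \<in> {0..<1}"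
  by (induction n) (simp_all add: contract_range del: atLeastLessThan_iff)

text \<open>The offsets 1/2 and 1 become integers after doubling, so both branches are inverse
  branches of the same map.\<close>

lemma expand_contract:
  assumes "x \<in> {0..<1}"
  shows "expand (contract x) = x"
proof -
  have "- 2 * contract x = x + of_int (if x < x1 \<or> x2 \<le> x \<and> x < x3 then -1 else -2)"
    by (simp add: contract_def)
  then have "expand (contract x) = frac x"
    unfolding expand_def by (metis frac_add_of_int_right)
  then show ?thesis
    using assms by (simp add: frac_eq)
qed

text \<open>With \<open>k = 0\<close> this places iterated preimages on an expanding orbit; with
  \<open>k > 0\<close> it shows that the intermediate orbit points are values of
  \<open>contract\<close>.\<close>

lemma expand_funpow_contract_funpow:
  "x \<in> {0..<1} \<Longrightarrow> (expand ^^ n) ((contract ^^ (n + k)) x) = (contract ^^ k) x"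
proof (induction n)
  case (Suc n)
  have "(expand ^^ Suc n) ((contract ^^ (Suc n + k)) x)
      = (expand ^^ n) (expand (contract ((contract ^^ (n + k)) x)))"
    by (simp add: funpow_swap1)
  also have "\<dots> = (expand ^^ n) ((contract ^^ (n + k)) x)"
    by (simp add: expand_contract contract_funpow_range[OF Suc.prems] del: atLeastLessThan_iff)
  finally show ?case
    using Suc by simp
qed simp

text \<open>
  The four gaps below miss the range of the contraction. Their lengths add up to \<open>1/2\<close>, so
  one of them has length at least \<open>1/8\<close>.
\<close>

lemma contract_range_gap:
  obtains a b where "0 \<le> a" "b \<le> 1" "a + 1/32 \<le> b"
    "\<And>x. x \<in> {0..<1} \<Longrightarrow> \<not> (a < contract x \<and> contract x < b)"
proof -
  consider "x1 \<ge> 1/4" | "x2 - x1 \<ge> 1/4" | "x3 - x2 \<ge> 1/4" | "1 - x3 \<ge> 1/4"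
    by linarith
  then show ?thesis
  proof cases
    case 1
    then show ?thesis
      using x1 x2 x3 by (intro that[of "1 - x1/2" 1]) (auto simp: contract_def)
  next
    case 2
    then show ?thesis
      using x1 x2 x3 by (intro that[of "1/2 - x2/2" "1/2 - x1/2"]) (auto simp: contract_def)
  next
    case 3
    then show ?thesis
      using x1 x2 x3 by (intro that[of "1 - x3/2" "1 - x2/2"]) (auto simp: contract_def)
  next
    case 4
    then show ?thesis
      using x1 x2 x3 by (intro that[of 0 "1/2 - x3/2"]) (auto simp: contract_def)
  qed
qed

text \<open>A preimage of depth \<open>n\<close> equals the \<open>n\<close>-th
  \<open>expand\<close>-iterate of \<open>z\<close>, so it suffices that this orbit is finite or
  that the depth is bounded.\<close>

lemma finite_iterated_preimages:
  assumes "rational_or_rich z" "0 \<le> z" "z < 1"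
  shows "finite {y \<in> {0..<1}. \<exists>n. (contract ^^ n) y = z}" (is "finite ?P")
proof -
  have orbit: "y = (expand ^^ n) z" if "y \<in> {0..<1}" "(contract ^^ n) y = z" for y n
    using expand_funpow_contract_funpow[of y n 0] that by simp
  show ?thesis
  proof (cases "z \<in> \<rat>")
    case True
    then show ?thesis
      by (rule finite_subset[rotated, OF finite_expand_orbit_rational]) (use orbit assms in auto)
  next
    case False
    obtain a b where ab: "0 \<le> a" "b \<le> 1" "a + 1/32 \<le> b"
      and gap: "\<And>x. x \<in> {0..<1} \<Longrightarrow> \<not> (a < contract x \<and> contract x < b)"
      using contract_range_gap by blast
    obtain m where m: "a < frac (4 ^ m * z)" "frac (4 ^ m * z) < b"
      using rich_frac_in_interval[OF _ ab, of z] False assms(1)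
      by (auto simp: rational_or_rich_def)
    \<comment> \<open>At greater depth the \<open>2 * m\<close>-th \<open>expand\<close>-iterate of
      \<open>z\<close> would be a value of \<open>contract\<close>, yet it lies in the gap. The
      factor 2 arises because one digit shift is two steps of \<open>expand\<close>.\<close>
    have "n \<le> 2 * m" if y: "y \<in> {0..<1}" "(contract ^^ n) y = z" for y n
    proof (rule ccontr)
      assume "\<not> n \<le> 2 * m"
      then obtain k where k: "n = 2 * m + Suc k"
        by (metis add_Suc_right less_imp_Suc_add not_le)
      have "contract ((contract ^^ k) y) = (expand ^^ (2 * m)) z"
        using expand_funpow_contract_funpow[OF y(1), of "2 * m" "Suc k"] y(2) k by simp
      then have "contract ((contract ^^ k) y) = frac (4 ^ m * z)"
        using assms by (simp add: expand_funpow_double)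
      then show False
        using gap[OF contract_funpow_range[OF y(1), of k]] m by simp
    qed
    then have "?P \<subseteq> (\<lambda>n. (expand ^^ n) z) ` {..2 * m}"
      using orbit by blast
    then show ?thesis
      by (rule finite_subset) simp
  qed
qed

section \<open>The invariant partition cut out by the singular points\<close>

definition singular :: "real set" where
  "singular = {y \<in> {0..<1}. \<exists>n. (contract ^^ n) y \<in> {x1, x2, x3}}"

text \<open>Recording both strict and weak comparisons makes each singular point a cell of its own,
  apart from the open intervals on either side.\<close>

definition cell :: "real \<Rightarrow> real set \<times> real set" where
  "cell x = ({b \<in> singular. b < x}, {b \<in> singular. b \<le> x})"

lemma finite_singular:
  assumes "rational_or_rich x1" "rational_or_rich x2" "rational_or_rich x3"
  shows "finite singular"
proof -
  have "singular = (\<Union>z\<in>{x1, x2, x3}. {y \<in> {0..<1}. \<exists>n. (contract ^^ n) y = z})"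
    by (auto simp: singular_def)
  then show ?thesis
    using assms finite_iterated_preimages x1 x2 x3 by simp
qed

lemma cut_points_singular: "x1 \<in> singular" "x2 \<in> singular" "x3 \<in> singular"
proof -
  have "z \<in> singular" if "z \<in> {x1, x2, x3}" for z
    unfolding singular_def using that x1 x2 x3 by (auto intro!: exI[of _ "0::nat"])
  then show "x1 \<in> singular" "x2 \<in> singular" "x3 \<in> singular"
    by simp_all
qed

lemma singular_if_contract_singular:
  assumes "y \<in> {0..<1}" "contract y \<in> singular"
  shows "y \<in> singular"
proof -
  obtain n where "(contract ^^ n) (contract y) \<in> {x1, x2, x3}"
    using assms(2) unfolding singular_def by blast
  then have "(contract ^^ Suc n) y \<in> {x1, x2, x3}"
    by (simp add: funpow_swap1)
  then show ?thesis
    using assms(1) unfolding singular_def by blast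
qed

text \<open>Endpoints count too: a singular \<open>x\<close> is detected by the strict component, a
  singular \<open>y\<close> by the weak one.\<close>

lemma cell_eq_iff: "x < y \<Longrightarrow> cell x = cell y \<longleftrightarrow> {x..y} \<inter> singular = {}"
proof -
  assume "x < y"
  then have "(b < x \<longleftrightarrow> b < y) \<and> (b \<le> x \<longleftrightarrow> b \<le> y) \<longleftrightarrow> b \<notin> {x..y}" for b
    by auto
  moreover have "cell x = cell y \<longleftrightarrow> (\<forall>b\<in>singular. (b < x \<longleftrightarrow> b < y) \<and> (b \<le> x \<longleftrightarrow> b \<le> y))"
    unfolding cell_def prod.inject set_eq_iff mem_Collect_eq by blast
  ultimately show ?thesis
    by (simp add: disjoint_iff) blast
qed

text \<open>No cut point lies between \<open>x\<close> and \<open>y\<close>, so a single affine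
  branch acts there. A singular point in the image interval would pull back to a singular point
  between \<open>x\<close> and \<open>y\<close>.\<close>

lemma contract_cell_less:
  assumes "x \<in> {0..<1}" "y \<in> {0..<1}" "x < y" "cell x = cell y"
  shows "cell (contract x) = cell (contract y)" "dist (contract x) (contract y) = 1/2 * dist x y"
proof -
  have free: "{x..y} \<inter> singular = {}"
    using assms cell_eq_iff by blast
  have side: "(z < a \<longleftrightarrow> x < a) \<and> (a \<le> z \<longleftrightarrow> a \<le> x)" if "z \<in> {x..y}" "a \<in> singular" for z a
  proof -
    have "a \<notin> {x..y}"
      using free that by blast
    then show ?thesis
      using that(1) by auto
  qed
  have "contract z = (if x < x1 \<or> x2 \<le> x \<and> x < x3 then 1/2 else 1) - z/2" if "z \<in> {x..y}" for z
    unfolding contract_def using cut_points_singular[THEN side[OF that]] by auto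
  then obtain s where s: "\<And>z. z \<in> {x..y} \<Longrightarrow> contract z = s - z/2"
    by blast
  have xy: "contract x = s - x/2" "contract y = s - y/2"
    using s assms(3) by auto
  show "dist (contract x) (contract y) = 1/2 * dist x y"
    using assms(3) by (simp add: xy dist_real_def field_simps abs_if)
  \<comment> \<open>The slope is negative, so the image interval starts at
    \<open>contract y\<close>.\<close>
  have "b \<notin> singular" if b: "b \<in> {contract y..contract x}" for b
  proof
    assume "b \<in> singular"
    \<comment> \<open>The inverse of the affine branch, evaluated at \<open>b\<close>.\<close>
    have z: "2 * (s - b) \<in> {x..y}"
      using b by (auto simp: xy)
    then have "contract (2 * (s - b)) = s - 2 * (s - b) / 2"
      by (rule s)
    also have "\<dots> = b"
      by (simp add: field_simps)
    finally have preimage: "contract (2 * (s - b)) = b" .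
    have "2 * (s - b) \<in> singular"
    proof (rule singular_if_contract_singular)
      show "2 * (s - b) \<in> {0..<1}"
        using z assms(1,2) by auto
    qed (simp only: preimage \<open>b \<in> singular\<close>)
    then show False
      using free z by blast
  qed
  then have "cell (contract y) = cell (contract x)"
    using assms(3) by (subst cell_eq_iff) (auto simp: xy)
  then show "cell (contract x) = cell (contract y)" ..
qed

lemma contract_cell:
  assumes "x \<in> {0..<1}" "y \<in> {0..<1}" "cell x = cell y"
  shows "cell (contract x) = cell (contract y)" "dist (contract x) (contract y) \<le> 1/2 * dist x y"
proof -
  have "cell (contract x) = cell (contract y) \<and> dist (contract x) (contract y) \<le> 1/2 * dist x y"
  proof (cases x y rule: linorder_cases)
    case less
    then show ?thesis
      using contract_cell_less[of x y] assms by simp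
  next
    case greater
    then show ?thesis
      using contract_cell_less[of y x] assms by (simp add: dist_commute)
  qed simp
  then show "cell (contract x) = cell (contract y)" "dist (contract x) (contract y) \<le> 1/2 * dist x y"
    by blast+
qed

end

section \<open>Conjugacy with the Poincare map\<close>

text \<open>The parametrisation of the boundary as tent functions, which gives Lipschitz bounds
  without splitting into sides. The second coordinate has two tents because the vertex (0, 1, 0)
  corresponds to both 0 and 1.\<close>

definition boundary_point :: "real \<Rightarrow> real^3" where
  "boundary_point x = vector
    [max 0 (1 - 3 * \<bar>x - 2/3\<bar>),
     max 0 (1 - 3 * \<bar>x\<bar>) + max 0 (1 - 3 * \<bar>x - 1\<bar>),
     max 0 (1 - 3 * \<bar>x - 1/3\<bar>)]"

lemma boundary_point_sides:
  "0 \<le> x \<Longrightarrow> x \<le> 1/3 \<Longrightarrow> boundary_point x = vector [0, 1 - 3 * x, 3 * x]"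
  "1/3 \<le> x \<Longrightarrow> x \<le> 2/3 \<Longrightarrow> boundary_point x = vector [3 * x - 1, 0, 2 - 3 * x]"
  "2/3 \<le> x \<Longrightarrow> x \<le> 1 \<Longrightarrow> boundary_point x = vector [3 - 3 * x, 3 * x - 2, 0]"
  by (auto simp: boundary_point_def vec_eq_iff forall_3 abs_if max_def)

lemma state_boundary_iff:
  "v \<in> state_boundary \<longleftrightarrow> v $ 1 \<ge> 0 \<and> v $ 2 \<ge> 0 \<and> v $ 3 \<ge> 0 \<and> v $ 1 + v $ 2 + v $ 3 = 1
    \<and> (v $ 1 = 0 \<or> v $ 2 = 0 \<or> v $ 3 = 0)"
proof -
  have "(\<exists>i. v $ i = 0) \<longleftrightarrow> v $ 1 = 0 \<or> v $ 2 = 0 \<or> v $ 3 = 0"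
    by (metis tank_cases)
  then show ?thesis
    by (auto simp: state_boundary_def state_space_def forall_3 sum_3)
qed

lemma boundary_point_in_state_boundary:
  assumes "0 \<le> x" "x \<le> 1"
  shows "boundary_point x \<in> state_boundary"
proof -
  consider "x \<le> 1/3" | "1/3 \<le> x" "x \<le> 2/3" | "2/3 \<le> x"
    by linarith
  then show ?thesis
    using assms
    by cases (simp_all add: boundary_point_sides state_boundary_iff)
qed

lemma state_boundary_subset: "state_boundary \<subseteq> boundary_point ` {0..<1}"
proof
  fix v assume v: "v \<in> state_boundary"
  have nonneg: "v $ 1 \<ge> 0" "v $ 2 \<ge> 0" "v $ 3 \<ge> 0" and sum: "v $ 1 + v $ 2 + v $ 3 = 1"
    using v by (auto simp: state_boundary_iff)
  \<comment> \<open>The third case excludes the vertex (0, 1, 0), whose parameter there would be 1,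
    outside \<open>{0..<1}\<close>; the first case gives it parameter 0.\<close>
  consider "v $ 1 = 0" | "v $ 2 = 0" | "v $ 3 = 0" "v $ 1 > 0"
    using v by (fastforce simp: state_boundary_iff)
  then show "v \<in> boundary_point ` {0..<1}"
  proof cases
    case 1
    then show ?thesis
      using nonneg sum
      by (intro image_eqI[of _ _ "v $ 3 / 3"]) (auto simp: boundary_point_sides vec_eq_iff forall_3)
  next
    case 2
    then show ?thesis
      using nonneg sum
      by (intro image_eqI[of _ _ "(v $ 1 + 1) / 3"]) (auto simp: boundary_point_sides vec_eq_iff forall_3 field_simps)
  next
    case 3
    then show ?thesis
      using nonneg sum
      by (intro image_eqI[of _ _ "(v $ 2 + 2) / 3"]) (auto simp: boundary_point_sides vec_eq_iff forall_3 field_simps)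
  qed
qed

text \<open>Each of the four tents has Lipschitz constant 3, and the norm is at most the sum of the
  absolute coordinates.\<close>

lemma boundary_point_lipschitz: "dist (boundary_point x) (boundary_point y) \<le> 12 * dist x y"
proof -
  have hat: "\<bar>max 0 (1 - 3 * \<bar>x - a\<bar>) - max 0 (1 - 3 * \<bar>y - a\<bar>)\<bar> \<le> 3 * \<bar>x - y\<bar>" for a :: real
  proof -
    have "\<bar>max 0 b - max 0 c\<bar> \<le> \<bar>b - c\<bar>" for b c :: real
      by linarith
    also have "\<bar>(1 - 3 * \<bar>x - a\<bar>) - (1 - 3 * \<bar>y - a\<bar>)\<bar> = 3 * \<bar>\<bar>x - a\<bar> - \<bar>y - a\<bar>\<bar>"
    proof -
      have "\<bar>(1 - 3 * p) - (1 - 3 * q)\<bar> = 3 * \<bar>p - q\<bar>" for p q :: real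
        by (simp add: abs_if)
      then show ?thesis .
    qed
    also have "\<dots> \<le> 3 * \<bar>x - y\<bar>"
      using abs_triangle_ineq3[of "x - a" "y - a"] by simp
    finally show ?thesis .
  qed
  have triangle: "\<bar>(a + b) - (a' + b')\<bar> \<le> \<bar>a - a'\<bar> + \<bar>b - b'\<bar>" for a b a' b' :: real
    by linarith
  have "dist (boundary_point x) (boundary_point y)
      \<le> (\<Sum>i\<in>UNIV. \<bar>(boundary_point x - boundary_point y) $ i\<bar>)"
    unfolding dist_norm by (rule norm_le_l1_cart)
  also have "\<dots> \<le> 3 * \<bar>x - y\<bar> + (3 * \<bar>x - y\<bar> + 3 * \<bar>x - y\<bar>) + 3 * \<bar>x - y\<bar>"
    unfolding sum_3 boundary_point_def vector_minus_component vector_3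
    using hat[of 0] by (intro add_mono hat order_trans[OF triangle]) simp
  finally show ?thesis
    by (simp add: dist_real_def)
qed

section \<open>Server dynamics in the boundary coordinate\<close>

lemma empty_tank_vector:
  "empty_tank 1 (vector [a, b, c]) = vector [0, b + a/2, c + a/2]"
  "empty_tank 2 (vector [a, b, c]) = vector [a + b/2, 0, c + b/2]"
  "empty_tank 3 (vector [a, b, c]) = vector [a + c/2, b + c/2, 0]"
  by (simp_all add: empty_tank_def vec_eq_iff forall_3 axis_def)

text \<open>On each side, the prescribed ratio of parameters makes the two scaled volumes tie
  exactly at the cut point, so the server's choice depends only on the position relative to
  it.\<close>

lemma (in cut_points) poincare_map_boundary_point:
  assumes pos: "\<And>i j. i \<noteq> j \<Longrightarrow> d i j > 0"
    and d1: "d 1 3 / d 1 2 = 1 / (3 * x1) - 1"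
    and d2: "d 2 1 / d 2 3 = (2 - 3 * x2) / (3 * x2 - 1)"
    and d3: "d 3 2 / d 3 1 = (3 - 3 * x3) / (3 * x3 - 2)"
    and x: "x \<in> {0..<1}"
  shows "poincare_map d (boundary_point x) = boundary_point (contract x)"
proof -
  have p: "d 1 2 > 0" "d 2 3 > 0" "d 3 1 > 0"
    by (auto intro!: pos)
  have sb: "boundary_point x \<in> state_boundary"
    using x by (intro boundary_point_in_state_boundary) auto
  \<comment> \<open>At a vertex two coordinates vanish; either may serve as the empty tank, so each
    side can be treated with one fixed \<open>i\<close>.\<close>
  have F: "poincare_map d (boundary_point x) = empty_tank (next_tank d i (boundary_point x)) (boundary_point x)"
    if "boundary_point x $ i = 0" for i
    using that by (intro poincare_map_eq pos sb)
  consider "x < 1/3" | "1/3 \<le> x" "x < 2/3" | "2/3 \<le> x"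
    by linarith
  then show ?thesis
  proof cases
    case 1
    have v: "boundary_point x = vector [0, 1 - 3 * x, 3 * x]"
      using 1 x by (simp add: boundary_point_sides)
    have e: "d 1 3 = d 1 2 * (1 / (3 * x1) - 1)"
      using d1 p by (simp add: field_simps)
    have "d 1 2 * (1 - 3 * x) > d 1 3 * (3 * x) \<longleftrightarrow> d 1 2 * (1 - 3 * x) > d 1 2 * ((1 / (3 * x1) - 1) * (3 * x))"
      by (simp add: e mult.assoc)
    also have "\<dots> \<longleftrightarrow> 1 - 3 * x > (1 / (3 * x1) - 1) * (3 * x)"
      by (simp only: mult_less_cancel_left_pos p)
    also have "\<dots> \<longleftrightarrow> x < x1"
      using x1 by (simp add: field_simps)
    finally have n: "next_tank d 1 (boundary_point x) = (if x < x1 then 2 else 3)"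
      by (simp only: next_tank_def v tank_arith vector_3)
    show ?thesis
      using F[of 1] 1 x x1 x2
      by (auto simp: n, auto simp: v empty_tank_vector contract_def boundary_point_sides vec_eq_iff forall_3 field_simps)
  next
    case 2
    have v: "boundary_point x = vector [3 * x - 1, 0, 2 - 3 * x]"
      using 2 x by (simp add: boundary_point_sides)
    have e: "d 2 1 = d 2 3 * ((2 - 3 * x2) / (3 * x2 - 1))"
      using d2 p by (simp add: field_simps)
    have "d 2 3 * (2 - 3 * x) > d 2 1 * (3 * x - 1)
        \<longleftrightarrow> d 2 3 * (2 - 3 * x) > d 2 3 * ((2 - 3 * x2) / (3 * x2 - 1) * (3 * x - 1))"
      by (simp add: e mult.assoc)
    also have "\<dots> \<longleftrightarrow> 2 - 3 * x > (2 - 3 * x2) / (3 * x2 - 1) * (3 * x - 1)"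
      by (simp only: mult_less_cancel_left_pos p)
    also have "\<dots> \<longleftrightarrow> x < x2"
      using x2 by (simp add: field_simps)
    finally have n: "next_tank d 2 (boundary_point x) = (if x < x2 then 3 else 1)"
      by (simp only: next_tank_def v tank_arith vector_3)
    show ?thesis
      using F[of 2] 2 x x1 x2 x3
      by (auto simp: n, auto simp: v empty_tank_vector contract_def boundary_point_sides vec_eq_iff forall_3 field_simps)
  next
    case 3
    have v: "boundary_point x = vector [3 - 3 * x, 3 * x - 2, 0]"
      using 3 x by (simp add: boundary_point_sides)
    have e: "d 3 2 = d 3 1 * ((3 - 3 * x3) / (3 * x3 - 2))"
      using d3 p by (simp add: field_simps)
    have "d 3 1 * (3 - 3 * x) > d 3 2 * (3 * x - 2)
        \<longleftrightarrow> d 3 1 * (3 - 3 * x) > d 3 1 * ((3 - 3 * x3) / (3 * x3 - 2) * (3 * x - 2))"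
      by (simp add: e mult.assoc)
    also have "\<dots> \<longleftrightarrow> 3 - 3 * x > (3 - 3 * x3) / (3 * x3 - 2) * (3 * x - 2)"
      by (simp only: mult_less_cancel_left_pos p)
    also have "\<dots> \<longleftrightarrow> x < x3"
      using x3 by (simp add: field_simps)
    finally have n: "next_tank d 3 (boundary_point x) = (if x < x3 then 1 else 2)"
      by (simp only: next_tank_def v tank_arith vector_3)
    show ?thesis
      using F[of 3] 3 x x1 x2 x3
      by (auto simp: n, auto simp: v empty_tank_vector contract_def boundary_point_sides vec_eq_iff forall_3 field_simps)
  qed
qed

theorem corollary2p3:
  fixes x1 x2 x3 d1 d2 d3 :: real
    and d :: "3 \<Rightarrow> 3 \<Rightarrow> real"
  assumes "x1 \<in> {0<..<1/3}" and "x2 \<in> {1/3<..<2/3}" and "x3 \<in> {2/3<..<1}"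
    and "rational_or_rich x1" and "rational_or_rich x2" and "rational_or_rich x3"
    and "d1 > 0" and "d2 > 0" and "d3 > 0"
    and "d1 = 1 / (3 * x1) - 1"
    and "d2 = (2 - 3 * x2) / (3 * x2 - 1)"
    and "d3 = (3 - 3 * x3) / (3 * x3 - 2)"
    and "\<And>i j. i \<noteq> j \<Longrightarrow> d i j > 0"
    and "d 1 3 / d 1 2 = d1" and "d 2 1 / d 2 3 = d2" and "d 3 2 / d 3 1 = d3"
  shows "finite (global_attractor state_boundary (poincare_map d))"
proof -
  interpret cut_points x1 x2 x3
    using assms(1-3) by unfold_locales auto
  show ?thesis
  proof (rule finite_global_attractor_if_contracting_partition)
    \<comment> \<open>Labels are pairs of subsets of the finite set \<open>singular\<close>; this is
      where rationality or richness of the cut points enters.\<close>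
    show "finite (cell ` {0..<1})"
    proof (rule finite_subset)
      show "cell ` {0..<1} \<subseteq> Pow singular \<times> Pow singular"
        by (auto simp: cell_def)
      show "finite (Pow singular \<times> Pow singular)"
        using finite_singular assms(4-6) by simp
    qed
    have "d 1 3 / d 1 2 = 1 / (3 * x1) - 1" "d 2 1 / d 2 3 = (2 - 3 * x2) / (3 * x2 - 1)"
      "d 3 2 / d 3 1 = (3 - 3 * x3) / (3 * x3 - 2)"
      using assms(10-12,14-16) by argo+
    then show "poincare_map d (boundary_point x) = boundary_point (contract x)" if "x \<in> {0..<1}" for x
      by (rule poincare_map_boundary_point[where d = d, rotated]) (rule that, rule assms(13))
    show "dist (boundary_point x) (boundary_point y) \<le> 12 * dist x y" for x y
      by (rule boundary_point_lipschitz)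
    show "cell (contract x) = cell (contract y)" "dist (contract x) (contract y) \<le> 1/2 * dist x y"
      if "x \<in> {0..<1}" "y \<in> {0..<1}" "cell x = cell y" for x y
      using contract_cell[OF that] .
  qed (rule state_boundary_subset contract_range | simp)+
qed

end
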